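(* Let $p\geq3$ be a prime and let $\mathcal{T}_{\mathrm{W},p}$ be the system of $\mathbb{F}_p$-equations $x_1-x_2-x_3+x_4=0$, $x_1-2x_3+x_5=0$ in five variables. Then there exists $C_{\mathrm{W}}(p)<p$ such that for every $n\in\mathbb{N}$, \[ \mathrm{ex}^{\sharp}_{\mathcal{T}_{\mathrm{W},p}}(n)\leq 7\left(\sqrt{C_{\mathrm{W}}(p)\cdot p}\right)^n . \] Furthermore, one may take $C_{\mathrm{W}}(p)=\inf\{\max\{\Lambda_{1,\alpha,p-1},\Lambda_{2,\beta,p-1}\}: 3\alpha+2\beta=2,\ \alpha\geq0,\ \beta\geq0\}$.
   Context: For a system $\mathcal{T}$ of $\mathbb{F}_p$-equations in $r$ variables, $A\subseteq\mathbb{F}_p^n$ is weakly $\mathcal{T}$-free if there is no solution $(x_1,\dots,x_r)\in A^r$ of $\mathcal{T}$ with $x_1,\dots,x_r$ pairwise distinct, and $\mathrm{ex}^{\sharp}_{\mathcal{T}}(n)$ is the maximum size of a weakly $\mathcal{T}$-free subset of $\mathbb{F}_p^n$. For $m,h\in\mathbb{N}$ and $\alpha>0$, $\Lambda_{m,\alpha,h}=\min_{u\in(0,1]}u^{-\alpha h}(1+u+u^2+\cdots+u^{mh})$, and $\Lambda_{m,0,h}=1$. *)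

theory Defs
  imports
    "HOL-Analysis.Analysis"
    "Jordan_Normal_Form.Matrix"
    "Berlekamp_Zassenhaus.Finite_Field"
begin

unbundle no vec_syntax

text \<open>A system of homogeneous linear equations is given by its coefficient matrix: one row per
  equation and one column per variable. The unknowns range over \<^term>\<open>carrier_vec n\<close>.\<close>

definition solves :: "'a::comm_ring_1 mat \<Rightarrow> nat \<Rightarrow> 'a vec list \<Rightarrow> bool" where
  "solves T n xs \<longleftrightarrow> length xs = dim_col T \<and> set xs \<subseteq> carrier_vec n \<and>
     (\<forall>l<dim_row T. finsum_vec TYPE('a) n (\<lambda>i. T $$ (l, i) \<cdot>\<^sub>v xs ! i) {..<dim_col T} = 0\<^sub>v n)"

definition weakly_free :: "'a::comm_ring_1 mat \<Rightarrow> nat \<Rightarrow> 'a vec set \<Rightarrow> bool" where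
  "weakly_free T n A \<longleftrightarrow> \<not> (\<exists>xs. set xs \<subseteq> A \<and> distinct xs \<and> solves T n xs)"

definition ex_sharp :: "'a::{comm_ring_1,finite} mat \<Rightarrow> nat \<Rightarrow> nat" where
  "ex_sharp T n = Max {card A | A. A \<subseteq> carrier_vec n \<and> weakly_free T n A}"

definition T_W :: "'a::comm_ring_1 mat" where
  "T_W = mat_of_rows_list 5 [[1, -1, -1, 1, 0], [1, 0, -2, 0, 1]]"

text \<open>For \<open>\<alpha> > 0\<close> the infimum below is a minimum, see \<open>Lambda_min\<close>;
  for \<open>\<alpha> = 0\<close> it need not be attained, and the value 1 is a convention.\<close>

definition Lambda :: "nat \<Rightarrow> real \<Rightarrow> nat \<Rightarrow> real" where
  "Lambda m \<alpha> h = (if \<alpha> = 0 then 1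
     else (INF u\<in>{0<..1}. u powr (-(\<alpha> * real h)) * (\<Sum>i\<le>m * h. u ^ i)))"

definition C_W :: "nat \<Rightarrow> real" where
  "C_W p = Inf {max (Lambda 1 \<alpha> (p - 1)) (Lambda 2 \<beta> (p - 1)) | \<alpha> \<beta>.
     3 * \<alpha> + 2 * \<beta> = 2 \<and> \<alpha> \<ge> 0 \<and> \<beta> \<ge> 0}"

lemma solves_T_W:
  fixes x1 x2 x3 x4 x5 :: "'a::comm_ring_1 vec"
  assumes "x1 \<in> carrier_vec n" "x2 \<in> carrier_vec n" "x3 \<in> carrier_vec n"
    "x4 \<in> carrier_vec n" "x5 \<in> carrier_vec n"
  shows "solves T_W n [x1, x2, x3, x4, x5] \<longleftrightarrow>
    x1 - x2 - x3 + x4 = 0\<^sub>v n \<and> x1 - 2 \<cdot>\<^sub>v x3 + x5 = 0\<^sub>v n"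
proof -
  let ?xs = "[x1, x2, x3, x4, x5]"
  let ?s = "\<lambda>l. finsum_vec TYPE('a) n (\<lambda>i. (T_W :: 'a mat) $$ (l, i) \<cdot>\<^sub>v ?xs ! i) {..<5}"
  have "solves T_W n ?xs \<longleftrightarrow> (\<forall>l<2. ?s l = 0\<^sub>v n)"
    using assms by (simp add: solves_def T_W_def mat_of_rows_list_def numeral_2_eq_2)
  moreover have cl: "(\<lambda>i. (T_W :: 'a mat) $$ (l, i) \<cdot>\<^sub>v ?xs ! i) \<in> {..<5} \<rightarrow> carrier_vec n" for l
    using assms by (auto simp: eval_nat_numeral less_Suc_eq)
  have dim: "dim_vec (?s l) = n" for l
    using finsum_vec_closed[OF cl[of l]] by simp
  have idx: "?s l $ k = (\<Sum>i<5. ((T_W :: 'a mat) $$ (l, i) \<cdot>\<^sub>v ?xs ! i) $ k)" if "k < n" for l k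
    using index_finsum_vec[OF _ that cl[of l]] by simp
  have "?s 0 = x1 - x2 - x3 + x4"
  proof (rule eq_vecI)
    fix k assume "k < dim_vec (x1 - x2 - x3 + x4)"
    then have k: "k < n" using assms by simp
    show "?s 0 $ k = (x1 - x2 - x3 + x4) $ k"
      unfolding idx[OF k] using assms k
      by (simp add: T_W_def mat_of_rows_list_def eval_nat_numeral)
  qed (use assms dim in simp)
  moreover have "?s 1 = x1 - 2 \<cdot>\<^sub>v x3 + x5"
  proof (rule eq_vecI)
    fix k assume "k < dim_vec (x1 - 2 \<cdot>\<^sub>v x3 + x5)"
    then have k: "k < n" using assms by simp
    show "?s 1 $ k = (x1 - 2 \<cdot>\<^sub>v x3 + x5) $ k"
      unfolding idx[OF k] using assms k
      by (simp add: T_W_def mat_of_rows_list_def eval_nat_numeral)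
  qed (use assms dim in simp)
  ultimately show ?thesis
    by (auto simp: numeral_2_eq_2 less_Suc_eq)
qed

lemma finite_carrier_vec_finite: "finite (carrier_vec n :: 'a::finite vec set)"
proof -
  have "carrier_vec n \<subseteq> vec_of_list ` {xs :: 'a list. set xs \<subseteq> UNIV \<and> length xs = n}"
  proof
    fix v :: "'a vec" assume "v \<in> carrier_vec n"
    then show "v \<in> vec_of_list ` {xs. set xs \<subseteq> UNIV \<and> length xs = n}"
      by (intro image_eqI[of _ _ "list_of_vec v"]) (auto simp: vec_list)
  qed
  then show ?thesis
    by (rule finite_subset) (intro finite_imageI finite_lists_length_eq finite)
qed

lemma ex_sharp_le_iff:
  fixes T :: "'a::{comm_ring_1,finite} mat"
  assumes "dim_col T > 0"
  shows "ex_sharp T n \<le> N \<longleftrightarrow>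
    (\<forall>A\<subseteq>carrier_vec n. weakly_free T n A \<longrightarrow> card A \<le> N)"
proof -
  let ?S = "{card A | A. A \<subseteq> carrier_vec n \<and> weakly_free T n A}"
  have "?S \<subseteq> card ` Pow (carrier_vec n :: 'a vec set)" by auto
  then have "finite ?S"
    by (rule finite_subset) (simp add: finite_carrier_vec_finite)
  moreover have "weakly_free T n {}"
    using assms by (auto simp: weakly_free_def solves_def)
  then have "?S \<noteq> {}" by blast
  ultimately show ?thesis unfolding ex_sharp_def by (subst Max_le_iff) auto
qed

lemma Lambda_min:
  assumes "\<alpha> > 0"
  shows "\<exists>u\<in>{0<..1}. Lambda m \<alpha> h = u powr (-(\<alpha> * real h)) * (\<Sum>i\<le>m * h. u ^ i) \<and>
    (\<forall>v\<in>{0<..1}. Lambda m \<alpha> h \<le> v powr (-(\<alpha> * real h)) * (\<Sum>i\<le>m * h. v ^ i))"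
proof -
  let ?f = "\<lambda>u::real. u powr (-(\<alpha> * real h)) * (\<Sum>i\<le>m * h. u ^ i)"
  have "\<exists>u\<in>{0<..1}. \<forall>v\<in>{0<..1}. ?f u \<le> ?f v"
  proof (cases "h = 0")
    case True
    then show ?thesis by (intro bexI[of _ 1]) auto
  next
    case False
    define c where "c = \<alpha> * real h"
    have c: "c > 0" using False assms by (simp add: c_def)
    define N where "N = real (m * h + 1)"
    have N: "N \<ge> 1" by (simp add: N_def)
    define e where "e = N powr (-(1 / c))"
    have e0: "e > 0" using N by (simp add: e_def)
    have "e \<le> N powr 0" unfolding e_def
      using c N by (intro powr_mono) auto
    also have "\<dots> = 1" using N by simp
    finally have e1: "e \<le> 1" .
    have "continuous_on {e..1} ?f" using e0 by (intro continuous_intros) auto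
    then obtain u where u: "u \<in> {e..1}" "\<And>v. v \<in> {e..1} \<Longrightarrow> ?f u \<le> ?f v"
      using continuous_attains_inf[of "{e..1}" ?f] e1 by auto
    have "?f u \<le> ?f v" if v: "v \<in> {0<..1}" for v
    proof (cases "v \<ge> e")
      case True
      then show ?thesis using u v by auto
    next
      case False
      have "?f u \<le> ?f 1" using u(2)[of 1] e1 by simp
      also have "?f 1 = N" by (simp add: N_def)
      also have "\<dots> = e powr (-c)"
        using c N by (simp add: e_def powr_powr)
      also have "\<dots> \<le> v powr (-c)"
        using False v c by (intro powr_mono2') auto
      also have "\<dots> * 1 \<le> ?f v" unfolding c_def
      proof (rule mult_left_mono)
        have "v ^ 0 \<le> (\<Sum>i\<le>m * h. v ^ i)"
          using v by (intro member_le_sum) auto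
        then show "1 \<le> (\<Sum>i\<le>m * h. v ^ i)" by simp
      qed simp
      finally show ?thesis by simp
    qed
    then show ?thesis using u(1) e0 by (intro bexI[of _ u]) auto
  qed
  then obtain u where u: "u \<in> {0<..1}" "\<And>v. v \<in> {0<..1} \<Longrightarrow> ?f u \<le> ?f v" by blast
  have "(INF u\<in>{0<..1}. ?f u) = ?f u"
    using u by (intro cInf_eq_minimum) auto
  then have "Lambda m \<alpha> h = ?f u" using assms by (simp add: Lambda_def)
  then show ?thesis using u by (intro bexI[of _ u]) auto
qed

end

theory Submission
  imports Defs "HOL-Library.Function_Algebras"
begin

text \<open>Let \<open>L\<close> bound the number of exponent vectors in \<open>{0..p-1}\<^sup>n\<close> of weight at most \<open>n(p-1)/3\<close>, so
  \<open>L = Lambda 1 (1/3) (p-1) ^ n \<le> C_W p ^ n\<close> will do. By the slice rank method a tricolored sum-free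
  set over \<open>F_p^n\<close> has at most \<open>3L\<close> members; hence a W-free set \<open>A\<close> contains a family of \<open>N\<close> disjoint
  three-term progressions with \<open>|A| \<le> 3L + 3N\<close>. Consider the progressions whose first, middle and
  last terms come from the first, middle and last terms of members of the family. Two of them with the
  same difference, or with opposite differences, would form a W, so there are at most \<open>p^n / 2\<close> of them.
  Turan's theorem then yields a subfamily of at least \<open>N\<^sup>2 / p^n\<close> members that is tricolored sum-free,
  whence \<open>N\<^sup>2 \<le> 3L p^n\<close>, and \<open>|A| \<le> 7 sqrt (L p^n)\<close> follows.\<close>

section \<open>Slice rank and tricolored sum-free sets\<close>

text \<open>Gaussian elimination: each slice in the third variable is removed at the price of at
  most one index. The functions \<open>f\<close> and \<open>g\<close> survive unchanged, so the
  slices in the other two variables do not multiply.\<close>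

lemma diagonal_slice_elim:
  fixes f g h :: "'b \<Rightarrow> 'i \<Rightarrow> 'a::field"
  assumes "finite C" "finite I"
    and "\<And>i j k. i \<in> I \<Longrightarrow> j \<in> I \<Longrightarrow> k \<in> I \<Longrightarrow> of_bool (i = j \<and> j = k) =
      (\<Sum>a\<in>A. f a i * F a j k) + (\<Sum>b\<in>B. g b j * G b i k) + (\<Sum>c\<in>C. h c k * H c i j)"
  shows "\<exists>J\<subseteq>I. \<exists>F' G'. card I \<le> card J + card C \<and>
    (\<forall>i\<in>J. \<forall>j\<in>J. \<forall>k\<in>J. of_bool (i = j \<and> j = k) =
      (\<Sum>a\<in>A. f a i * F' a j k) + (\<Sum>b\<in>B. g b j * G' b i k))"
  using assms
proof (induction C arbitrary: I F G h rule: finite_induct)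
  case empty
  then show ?case by (intro exI[of _ I] exI[of _ F] exI[of _ G] conjI) auto
next
  case (insert c C)
  let ?R = "\<lambda>F G h i j k. (\<Sum>a\<in>A. f a i * F a j k) + (\<Sum>b\<in>B. g b j * G b i k) + (\<Sum>c\<in>C. h c k * H c i j)"
  have eq: "of_bool (i = j \<and> j = k) = h c k * H c i j + ?R F G h i j k"
    if "i \<in> I" "j \<in> I" "k \<in> I" for i j k
    using insert.prems(2)[OF that] insert.hyps by (simp add: algebra_simps)
  show ?case
  proof (cases "\<exists>k\<in>I. h c k \<noteq> 0")
    case False
    have "of_bool (i = j \<and> j = k) = ?R F G h i j k" if "i \<in> I" "j \<in> I" "k \<in> I" for i j k
      using eq[OF that] False that by auto
    from insert.IH[of I F G h, OF insert.prems(1) this]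
    obtain J F' G' where J: "J \<subseteq> I" "card I \<le> card J + card C"
      "\<forall>i\<in>J. \<forall>j\<in>J. \<forall>k\<in>J. of_bool (i = j \<and> j = k) =
        (\<Sum>a\<in>A. f a i * F' a j k) + (\<Sum>b\<in>B. g b j * G' b i k)"
      by blast
    have "card I \<le> card J + card (insert c C)"
      using J(2) insert.hyps by simp
    with J show ?thesis by blast
  next
    case True
    then obtain l where l: "l \<in> I" "h c l \<noteq> 0" by blast
    define q where "q k = h c k / h c l" for k
    define F' where "F' a j k = F a j k - q k * F a j l" for a j k
    define G' where "G' b i k = G b i k - q k * G b i l" for b i k
    define h' where "h' d k = h d k - q k * h d l" for d k
    \<comment> \<open>Subtracting a multiple of the layer \<open>k = l\<close> kills slice \<open>c\<close>; that layer of the diagonal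
      tensor vanishes off \<open>l\<close>, so the tensor is unchanged on the remaining indices.\<close>
    have "of_bool (i = j \<and> j = k) = ?R F' G' h' i j k"
      if "i \<in> I - {l}" "j \<in> I - {l}" "k \<in> I - {l}" for i j k
    proof -
      have "of_bool (i = j \<and> j = k) = of_bool (i = j \<and> j = k) - q k * of_bool (i = j \<and> j = l)"
        using that by simp
      also have "\<dots> = (h c k * H c i j + ?R F G h i j k) - q k * (h c l * H c i j + ?R F G h i j l)"
        using eq[of i j k] eq[of i j l] that l(1) by simp
      also have "\<dots> = ?R F G h i j k - q k * ?R F G h i j l"
        using l(2) by (simp add: q_def algebra_simps)
      also have "\<dots> = ?R F' G' h' i j k"
        by (simp add: F'_def G'_def h'_def algebra_simps sum_subtractf sum_distrib_left)
      finally show ?thesis .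
    qed
    from insert.IH[of "I - {l}" F' G' h', OF _ this] insert.prems(1)
    obtain J F'' G'' where J: "J \<subseteq> I - {l}" "card (I - {l}) \<le> card J + card C"
      "\<forall>i\<in>J. \<forall>j\<in>J. \<forall>k\<in>J. of_bool (i = j \<and> j = k) =
        (\<Sum>a\<in>A. f a i * F'' a j k) + (\<Sum>b\<in>B. g b j * G'' b i k)"
      by blast
    have "card I \<le> card J + card (insert c C)"
      using J(2) l(1) insert.prems(1) insert.hyps by (simp add: card_Diff_singleton)
    with J show ?thesis by blast
  qed
qed

text \<open>Elimination is applied three times, with the variables permuted so that the group to be
  removed stands third. No slice is left at the end, hence no index either.\<close>

lemma diagonal_slice_rank:
  fixes f g h :: "'b \<Rightarrow> 'i \<Rightarrow> 'a::field"
  assumes fin: "finite A" "finite B" "finite C" "finite I"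
    and eq: "\<And>i j k. i \<in> I \<Longrightarrow> j \<in> I \<Longrightarrow> k \<in> I \<Longrightarrow> of_bool (i = j \<and> j = k) =
      (\<Sum>a\<in>A. f a i * F a j k) + (\<Sum>b\<in>B. g b j * G b i k) + (\<Sum>c\<in>C. h c k * H c i j)"
  shows "card I \<le> card A + card B + card C"
proof -
  obtain J F1 G1 where J: "J \<subseteq> I" "card I \<le> card J + card C"
    "\<forall>i\<in>J. \<forall>j\<in>J. \<forall>k\<in>J. of_bool (i = j \<and> j = k) =
      (\<Sum>a\<in>A. f a i * F1 a j k) + (\<Sum>b\<in>B. g b j * G1 b i k)"
    using diagonal_slice_elim[OF fin(3,4) eq] by blast
  have finJ: "finite J" using J(1) fin(4) by (rule finite_subset)
  \<comment> \<open>Exchanging the last two variables moves the group \<open>B\<close> to the third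
    position; an empty sum fills the second.\<close>
  have eqJ: "of_bool (i = j \<and> j = k) = (\<Sum>a\<in>A. f a i * F1 a k j) + (\<Sum>b\<in>{}. g b j * G1 b i k)
      + (\<Sum>b\<in>B. g b k * G1 b i j)" if "i \<in> J" "j \<in> J" "k \<in> J" for i j k
  proof -
    have "i = j \<and> j = k \<longleftrightarrow> i = k \<and> k = j" by auto
    then show ?thesis using J(3)[rule_format, of i k j] that by simp
  qed
  obtain K F2 G2 where K: "K \<subseteq> J" "card J \<le> card K + card B"
    "\<forall>i\<in>K. \<forall>j\<in>K. \<forall>k\<in>K. of_bool (i = j \<and> j = k) =
      (\<Sum>a\<in>A. f a i * F2 a j k) + (\<Sum>b\<in>{}. g b j * G2 b i k)"
    using diagonal_slice_elim[OF fin(2) finJ eqJ] by blast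
  have finK: "finite K" using K(1) finJ by (rule finite_subset)
  have eqK: "of_bool (i = j \<and> j = k) = (\<Sum>b\<in>{}. f b i * F2 b j k) + (\<Sum>b\<in>{}. g b j * G1 b i k)
      + (\<Sum>a\<in>A. f a k * F2 a i j)" if "i \<in> K" "j \<in> K" "k \<in> K" for i j k
  proof -
    have "i = j \<and> j = k \<longleftrightarrow> k = i \<and> i = j" by auto
    then show ?thesis using K(3)[rule_format, of k i j] that by simp
  qed
  obtain L F3 G3 where L: "L \<subseteq> K" "card K \<le> card L + card A"
    "\<forall>i\<in>L. \<forall>j\<in>L. \<forall>k\<in>L. of_bool (i = j \<and> j = k) =
      (\<Sum>b\<in>{}. f b i * F3 b j k) + (\<Sum>b\<in>{}. g b j * G3 b i k)"
    using diagonal_slice_elim[OF fin(1) finK eqK] by blast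
  \<comment> \<open>All sums are empty by now, whereas the left side is 1 at
    \<open>i = j = k\<close>.\<close>
  have "L = {}" using L(3) by force
  with L(2) K(2) J(2) show ?thesis by simp
qed

text \<open>Trinomial theorem, with coefficients \<open>w\<close> independent of the point. Over a
  field with \<open>h + 1\<close> elements the left side is the indicator of
  \<open>x + y + z = 0\<close>, so this presents that indicator as a polynomial of degree at most
  \<open>h\<close>.\<close>

lemma one_minus_power_expansion:
  "\<exists>w. \<forall>x y z :: 'a::comm_ring_1. 1 - (x + y + z) ^ h =
    (\<Sum>(e, f, g)\<in>{(e, f, g). e + f + g \<le> h}. w (e, f, g) * x ^ e * y ^ f * z ^ g)"
proof -
  let ?S = "{(e, f, g). e + f + g \<le> h}"
  \<comment> \<open>The trinomial coefficient as a product of two binomials, set to 0 off the plane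
    \<open>e + f + g = h\<close>.\<close>
  define v :: "nat \<times> nat \<times> nat \<Rightarrow> 'a" where
    "v = (\<lambda>(e, f, g). of_bool (e + f + g = h) * of_nat (h choose e) * of_nat ((h - e) choose f))"
  have fin: "finite ?S"
    by (rule finite_subset[of _ "{..h} \<times> {..h} \<times> {..h}"]) auto
  have "1 - (x + y + z) ^ h = (\<Sum>(e, f, g)\<in>?S. (of_bool (e = 0 \<and> f = 0 \<and> g = 0) - v (e, f, g)) * x ^ e * y ^ f * z ^ g)"
    for x y z :: 'a
  proof -
    have "(x + y + z) ^ h = (\<Sum>e\<le>h. of_nat (h choose e) * x ^ e * (y + z) ^ (h - e))"
      by (simp add: binomial_ring add.assoc)
    also have "\<dots> = (\<Sum>e\<le>h. \<Sum>f\<le>h - e. v (e, f, h - e - f) * x ^ e * y ^ f * z ^ (h - e - f))"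
      by (intro sum.cong) (auto simp: binomial_ring v_def sum_distrib_left ac_simps)
    also have "\<dots> = (\<Sum>(e, f)\<in>(SIGMA e:{..h}. {..h - e}). v (e, f, h - e - f) * x ^ e * y ^ f * z ^ (h - e - f))"
      by (simp add: sum.Sigma)
    also have "\<dots> = (\<Sum>(e, f, g)\<in>{(e, f, g). e + f + g = h}. v (e, f, g) * x ^ e * y ^ f * z ^ g)"
      by (rule sum.reindex_bij_witness[of _ "\<lambda>(e, f, g). (e, f)" "\<lambda>(e, f). (e, f, h - e - f)"]) auto
    also have "\<dots> = (\<Sum>(e, f, g)\<in>?S. v (e, f, g) * x ^ e * y ^ f * z ^ g)"
      using fin by (intro sum.mono_neutral_left) (auto simp: v_def of_bool_def split: if_split_asm)
    finally have 1: "(x + y + z) ^ h = (\<Sum>(e, f, g)\<in>?S. v (e, f, g) * x ^ e * y ^ f * z ^ g)" .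
    have "(1::'a) = (\<Sum>(e, f, g)\<in>{(0, 0, 0)}. of_bool (e = 0 \<and> f = 0 \<and> g = 0) * x ^ e * y ^ f * z ^ g)"
      by simp
    also have "\<dots> = (\<Sum>(e, f, g)\<in>?S. of_bool (e = 0 \<and> f = 0 \<and> g = 0) * x ^ e * y ^ f * z ^ g)"
      using fin by (intro sum.mono_neutral_left) (auto simp: of_bool_def split: if_split_asm)
    finally show ?thesis unfolding 1
      by (simp add: case_prod_unfold sum_subtractf left_diff_distrib)
  qed
  then show ?thesis
    by (intro exI[of _ "\<lambda>(e, f, g). of_bool (e = 0 \<and> f = 0 \<and> g = 0) - v (e, f, g)"]) simp
qed

text \<open>The members stand for monomials in \<open>n\<close> variables; being extensional they
  form a finite set and fit \<open>prod_sum_PiE\<close>. The factor 3 avoids dividing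
  \<open>n * h\<close> in the naturals.\<close>

definition low_exps :: "nat \<Rightarrow> nat \<Rightarrow> (nat \<Rightarrow> nat) set" where
  "low_exps n h = {e \<in> {..<n} \<rightarrow>\<^sub>E {..h}. 3 * (\<Sum>c<n. e c) \<le> n * h}"

lemma finite_low_exps: "finite (low_exps n h)"
  unfolding low_exps_def by (rule finite_subset[of _ "{..<n} \<rightarrow>\<^sub>E {..h}"]) (auto intro: finite_PiE)

text \<open>The product over the coordinates of the indicators of
  \<open>x i c + y j c + z k c = 0\<close> is the diagonal tensor. It is a polynomial of total
  degree at most \<open>n * h\<close>, so each of its monomials has degree at most
  \<open>n * h / 3\<close> in one of the three vectors. Collecting terms by that low part gives one
  slice per vector and member of \<open>low_exps\<close>.\<close>

lemma tricolored_sum_free_card_le: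
  fixes x y z :: "'i \<Rightarrow> nat \<Rightarrow> 'a::finite_field"
  assumes fin: "finite I"
    and tri: "\<And>i j k. i \<in> I \<Longrightarrow> j \<in> I \<Longrightarrow> k \<in> I \<Longrightarrow>
      (\<forall>c<n. x i c + y j c + z k c = 0) \<longleftrightarrow> i = j \<and> j = k"
  shows "card I \<le> 3 * card (low_exps n (CARD('a) - 1))"
proof -
  define h where "h = CARD('a) - 1"
  have card: "CARD('a) = Suc h" "h > 0"
  proof -
    have "card {0, 1 :: 'a} \<le> CARD('a)" by (intro card_mono) auto
    then show "CARD('a) = Suc h" "h > 0" by (auto simp: h_def)
  qed
  \<comment> \<open>Nonzero \<open>a\<close> satisfy \<open>a ^ h = 1\<close>; at
    \<open>a = 0\<close> the power vanishes because \<open>h > 0\<close>.\<close>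
  have fermat: "1 - a ^ h = of_bool (a = 0)" for a :: 'a
    using finite_field_power_card_eq_same[of a] card by auto
  let ?S = "{(e, f, g). e + f + g \<le> h}"
  have finS: "finite ?S"
    by (rule finite_subset[of _ "{..h} \<times> {..h} \<times> {..h}"]) auto
  obtain w :: "nat \<times> nat \<times> nat \<Rightarrow> 'a" where w: "\<And>a b c. 1 - (a + b + c) ^ h =
      (\<Sum>(e, f, g)\<in>?S. w (e, f, g) * a ^ e * b ^ f * c ^ g)"
    using one_minus_power_expansion[of h, where 'a = 'a] by blast
  define P where "P = {..<n} \<rightarrow>\<^sub>E ?S"
  have finP: "finite P" unfolding P_def using finS by (intro finite_PiE) auto
  \<comment> \<open>\<open>m e v\<close> is the monomial with exponents \<open>e\<close> evaluated
    at \<open>v\<close>. A family \<open>t\<close> chooses one term of the expansion in each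
    coordinate, and \<open>p1\<close>, \<open>p2\<close>, \<open>p3\<close> read off its exponents
    in the three vectors.\<close>
  define m where "m e v = (\<Prod>c<n. v c ^ e c)" for e and v :: "nat \<Rightarrow> 'a"
  define p1 where "p1 t = (\<lambda>c\<in>{..<n}. fst (t c))" for t :: "nat \<Rightarrow> nat \<times> nat \<times> nat"
  define p2 where "p2 t = (\<lambda>c\<in>{..<n}. fst (snd (t c)))" for t :: "nat \<Rightarrow> nat \<times> nat \<times> nat"
  define p3 where "p3 t = (\<lambda>c\<in>{..<n}. snd (snd (t c)))" for t :: "nat \<Rightarrow> nat \<times> nat \<times> nat"
  define W where "W t = (\<Prod>c<n. w (t c))" for t
  let ?L = "low_exps n h"
  have low: "p1 t \<in> ?L \<or> p2 t \<in> ?L \<or> p3 t \<in> ?L" if "t \<in> P" for t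
  proof -
    have t: "fst (t c) + fst (snd (t c)) + snd (snd (t c)) \<le> h" if "c < n" for c
    proof -
      have "t c \<in> ?S" using PiE_mem[OF \<open>t \<in> P\<close>[unfolded P_def], of c] that by simp
      then show ?thesis by (cases "t c") simp
    qed
    have t': "fst (t c) \<le> h" "fst (snd (t c)) \<le> h" "snd (snd (t c)) \<le> h" if "c < n" for c
      using t[OF that] by auto
    have "(\<Sum>c<n. fst (t c)) + (\<Sum>c<n. fst (snd (t c))) + (\<Sum>c<n. snd (snd (t c))) \<le> (\<Sum>c<n. h)"
      unfolding sum.distrib[symmetric] using t by (intro sum_mono) auto
    then have "3 * (\<Sum>c<n. fst (t c)) \<le> n * h \<or> 3 * (\<Sum>c<n. fst (snd (t c))) \<le> n * h
        \<or> 3 * (\<Sum>c<n. snd (snd (t c))) \<le> n * h"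
      by simp linarith
    moreover have "p1 t \<in> {..<n} \<rightarrow>\<^sub>E {..h}" "p2 t \<in> {..<n} \<rightarrow>\<^sub>E {..h}" "p3 t \<in> {..<n} \<rightarrow>\<^sub>E {..h}"
      using t' by (auto simp: p1_def p2_def p3_def restrict_PiE_iff)
    ultimately show ?thesis by (simp add: low_exps_def p1_def p2_def p3_def)
  qed
  \<comment> \<open>Each \<open>t\<close> goes to the first of its three parts that is low, so that
    no term is counted twice.\<close>
  define P1 where "P1 = {t \<in> P. p1 t \<in> ?L}"
  define P2 where "P2 = {t \<in> P - P1. p2 t \<in> ?L}"
  define P3 where "P3 = P - P1 - P2"
  have P: "P = P1 \<union> P2 \<union> P3" "P1 \<inter> P2 = {}" "(P1 \<union> P2) \<inter> P3 = {}" "finite P1" "finite P2" "finite P3"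
    using finP by (auto simp: P1_def P2_def P3_def)
  have im: "p1 ` P1 \<subseteq> ?L" "p2 ` P2 \<subseteq> ?L" "p3 ` P3 \<subseteq> ?L"
    using low by (auto simp: P1_def P2_def P3_def)
  have group: "(\<Sum>t\<in>Q. m (q t) v * R t) = (\<Sum>e\<in>?L. m e v * (\<Sum>t\<in>{t \<in> Q. q t = e}. R t))"
    if "finite Q" "q ` Q \<subseteq> ?L" for Q q v R
    by (subst sum.group[OF that(1) finite_low_exps that(2), symmetric])
      (auto simp: sum_distrib_left intro!: sum.cong)
  have "of_bool (i = j \<and> j = k) =
      (\<Sum>e\<in>?L. m e (x i) * (\<Sum>t\<in>{t \<in> P1. p1 t = e}. W t * m (p2 t) (y j) * m (p3 t) (z k)))
    + (\<Sum>e\<in>?L. m e (y j) * (\<Sum>t\<in>{t \<in> P2. p2 t = e}. W t * m (p1 t) (x i) * m (p3 t) (z k)))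
    + (\<Sum>e\<in>?L. m e (z k) * (\<Sum>t\<in>{t \<in> P3. p3 t = e}. W t * m (p1 t) (x i) * m (p2 t) (y j)))"
    if "i \<in> I" "j \<in> I" "k \<in> I" for i j k
  proof -
    have "of_bool (i = j \<and> j = k) = (\<Prod>c<n. 1 - (x i c + y j c + z k c) ^ h)"
      using tri[OF that] by (auto simp: fermat)
    also have "\<dots> = (\<Prod>c<n. \<Sum>t\<in>?S. w t * x i c ^ fst t * y j c ^ fst (snd t) * z k c ^ snd (snd t))"
      by (simp add: w case_prod_unfold)
    \<comment> \<open>Multiplying out the product of sums: one summand for each choice of a term per
      coordinate.\<close>
    also have "\<dots> = (\<Sum>t\<in>P. W t * m (p1 t) (x i) * m (p2 t) (y j) * m (p3 t) (z k))"
      unfolding P_def using finS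
      by (subst prod_sum_PiE) (auto simp: prod.distrib W_def m_def p1_def p2_def p3_def)
    also have "\<dots> = (\<Sum>t\<in>P1. m (p1 t) (x i) * (W t * m (p2 t) (y j) * m (p3 t) (z k)))
        + (\<Sum>t\<in>P2. m (p2 t) (y j) * (W t * m (p1 t) (x i) * m (p3 t) (z k)))
        + (\<Sum>t\<in>P3. m (p3 t) (z k) * (W t * m (p1 t) (x i) * m (p2 t) (y j)))"
      unfolding P(1) using P(2-) by (simp add: sum.union_disjoint mult_ac)
    finally show ?thesis
      unfolding group[OF P(4) im(1)] group[OF P(5) im(2)] group[OF P(6) im(3)] .
  qed
  from diagonal_slice_rank[OF finite_low_exps finite_low_exps finite_low_exps fin this]
  show ?thesis by (simp add: h_def)
qed

text \<open>Exponential-moment bound: with the weight \<open>u powr (-h/3) * u ^ e c\<close> per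
  coordinate every low vector has product at least 1, and the sum of these products over all vectors
  factors into an \<open>n\<close>-th power.\<close>

lemma card_low_exps_le:
  assumes u: "0 < u" "u \<le> (1::real)"
  shows "real (card (low_exps n h)) \<le> (u powr (-(1 / 3 * real h)) * (\<Sum>i\<le>h. u ^ i)) ^ n"
proof -
  let ?c = "u powr (-(1 / 3 * real h))"
  have "real (card (low_exps n h)) = (\<Sum>e\<in>low_exps n h. 1)" by simp
  also have "\<dots> \<le> (\<Sum>e\<in>low_exps n h. \<Prod>c<n. ?c * u ^ e c)"
  proof (rule sum_mono)
    fix e assume "e \<in> low_exps n h"
    then have e: "3 * real (\<Sum>c<n. e c) \<le> real n * real h"
      unfolding low_exps_def mem_Collect_eq by (metis of_nat_le_iff of_nat_mult of_nat_numeral)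
    \<comment> \<open>As \<open>u\<close> is at most 1 it suffices that the new exponent is at most
      0, which is the weight bound \<open>e\<close>.\<close>
    have "1 = u powr 0" using u by simp
    also have "\<dots> \<le> u powr (real n * -(1 / 3 * real h) + real (\<Sum>c<n. e c))"
      using u e by (intro powr_mono') auto
    also have "\<dots> = ?c ^ n * u ^ (\<Sum>c<n. e c)"
    proof -
      have "?c ^ n = ?c powr real n" using u by (simp add: powr_realpow)
      then show ?thesis
        using u by (simp only: powr_add powr_realpow powr_powr) (simp add: mult.commute)
    qed
    also have "\<dots> = (\<Prod>c<n. ?c * u ^ e c)" by (simp add: prod.distrib power_sum)
    finally show "1 \<le> (\<Prod>c<n. ?c * u ^ e c)" .
  qed
  also have "\<dots> \<le> (\<Sum>e\<in>{..<n} \<rightarrow>\<^sub>E {..h}. \<Prod>c<n. ?c * u ^ e c)"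
    using u by (intro sum_mono2 finite_PiE prod_nonneg) (auto simp: low_exps_def)
  also have "\<dots> = (\<Prod>c<n. \<Sum>i\<le>h. ?c * u ^ i)"
    by (subst prod_sum_PiE) auto
  also have "\<dots> = (?c * (\<Sum>i\<le>h. u ^ i)) ^ n"
    by (simp add: sum_distrib_left)
  finally show ?thesis .
qed

section \<open>Independent sets in graphs\<close>

text \<open>Greedy choice of a vertex of minimum degree, deleting it with its neighbours. The
  deleted vertices have at least that degree, so their terms add up to at most 1; the remaining
  degrees can only drop, which enlarges their terms.\<close>

lemma caro_wei:
  fixes E :: "'v \<Rightarrow> 'v \<Rightarrow> bool"
  assumes "finite V" and sym: "\<And>u v. E u v \<Longrightarrow> E v u" and irr: "\<And>v. \<not> E v v"
  shows "\<exists>S\<subseteq>V. (\<forall>u\<in>S. \<forall>v\<in>S. \<not> E u v) \<and>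
    (\<Sum>v\<in>V. 1 / (real (card {w \<in> V. E v w}) + 1)) \<le> real (card S)"
  using assms(1)
proof (induction V rule: finite_psubset_induct)
  case (psubset V)
  let ?d = "\<lambda>V v. real (card {w \<in> V. E v w})"
  show ?case
  proof (cases "V = {}")
    case False
    then have "Min (?d V ` V) \<in> ?d V ` V"
      using psubset.hyps by (intro Min_in) auto
    then obtain v where v: "v \<in> V" "?d V v = Min (?d V ` V)" by auto
    then have v_min: "?d V v \<le> ?d V w" if "w \<in> V" for w
      using psubset.hyps that by auto
    define N where "N = insert v {w \<in> V. E v w}"
    have N: "N \<subseteq> V" "v \<in> N" using v by (auto simp: N_def)
    have finN: "finite N" using N(1) psubset.hyps by (rule finite_subset)
    have cardN: "real (card N) = ?d V v + 1"
      using psubset.hyps irr by (simp add: N_def)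
    have "V - N \<subset> V" using N v by blast
    from psubset.IH[OF this] obtain S where S: "S \<subseteq> V - N" "\<forall>u\<in>S. \<forall>v\<in>S. \<not> E u v"
      "(\<Sum>u\<in>V - N. 1 / (?d (V - N) u + 1)) \<le> real (card S)" by blast
    have "(\<Sum>u\<in>N. 1 / (?d V u + 1)) \<le> (\<Sum>u\<in>N. 1 / (?d V v + 1))"
      using v_min N(1) by (intro sum_mono divide_left_mono) (auto intro!: add_nonneg_pos mult_pos_pos)
    also have "\<dots> = 1" using cardN by (simp add: field_simps)
    finally have 1: "(\<Sum>u\<in>N. 1 / (?d V u + 1)) \<le> 1" .
    have 2: "(\<Sum>u\<in>V - N. 1 / (?d V u + 1)) \<le> (\<Sum>u\<in>V - N. 1 / (?d (V - N) u + 1))"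
      using psubset.hyps
      by (intro sum_mono divide_left_mono add_right_mono of_nat_mono card_mono)
        (auto intro!: add_nonneg_pos mult_pos_pos)
    have "(\<Sum>u\<in>V. 1 / (?d V u + 1)) = (\<Sum>u\<in>V - N. 1 / (?d V u + 1)) + (\<Sum>u\<in>N. 1 / (?d V u + 1))"
      using psubset.hyps N by (intro sum.subset_diff) auto
    also have "\<dots> \<le> real (card S) + 1" using 1 2 S(3) by linarith
    also have "\<dots> = real (card (insert v S))"
      using S(1) N(2) finite_subset[OF S(1)] psubset.hyps by (subst card_insert_disjoint) auto
    finally have "(\<Sum>u\<in>V. 1 / (?d V u + 1)) \<le> real (card (insert v S))" .
    moreover have "\<not> E u w" if "u \<in> insert v S" "w \<in> insert v S" for u w
      using that S(1,2) sym irr by (auto simp: N_def)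
    ultimately show ?thesis using S(1) v(1) by (intro exI[of _ "insert v S"]) auto
  qed auto
qed

text \<open>Cauchy-Schwarz turns the Caro-Wei sum into a bound by the average degree. Edges are
  counted as ordered pairs, so their number is the sum of the degrees.\<close>

lemma turan_independent_set:
  fixes E :: "'v \<Rightarrow> 'v \<Rightarrow> bool"
  assumes fin: "finite V" and sym: "\<And>u v. E u v \<Longrightarrow> E v u" and irr: "\<And>v. \<not> E v v"
  shows "\<exists>S\<subseteq>V. (\<forall>u\<in>S. \<forall>v\<in>S. \<not> E u v) \<and>
    (card V)\<^sup>2 \<le> card S * (card V + card {(u, v). u \<in> V \<and> v \<in> V \<and> E u v})"
proof -
  let ?d = "\<lambda>v. real (card {w \<in> V. E v w})"
  obtain S where S: "S \<subseteq> V" "\<forall>u\<in>S. \<forall>v\<in>S. \<not> E u v" "(\<Sum>v\<in>V. 1 / (?d v + 1)) \<le> real (card S)"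
    using caro_wei[of V E, OF fin sym irr] by blast
  have "{(u, v). u \<in> V \<and> v \<in> V \<and> E u v} = (SIGMA u:V. {w \<in> V. E u w})" by auto
  then have edges: "real (card {(u, v). u \<in> V \<and> v \<in> V \<and> E u v}) = (\<Sum>v\<in>V. ?d v)"
    using fin by simp
  have "(real (card V))\<^sup>2 = (\<Sum>v\<in>V. (1 / sqrt (?d v + 1)) * sqrt (?d v + 1))\<^sup>2"
    by (simp add: add_nonneg_eq_0_iff)
  also have "\<dots> \<le> (\<Sum>v\<in>V. (1 / sqrt (?d v + 1))\<^sup>2) * (\<Sum>v\<in>V. (sqrt (?d v + 1))\<^sup>2)"
    by (rule Cauchy_Schwarz_ineq_sum)
  also have "\<dots> = (\<Sum>v\<in>V. 1 / (?d v + 1)) * (\<Sum>v\<in>V. ?d v + 1)"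
    by (simp add: power_divide)
  also have "\<dots> \<le> real (card S) * (\<Sum>v\<in>V. ?d v + 1)"
    using S(3) by (intro mult_right_mono sum_nonneg) auto
  also have "\<dots> = real (card S) * (real (card V) + real (card {(u, v). u \<in> V \<and> v \<in> V \<and> E u v}))"
    unfolding edges by (simp add: sum.distrib)
  finally have "real ((card V)\<^sup>2) \<le> real (card S * (card V + card {(u, v). u \<in> V \<and> v \<in> V \<and> E u v}))"
    by simp
  then have "(card V)\<^sup>2 \<le> card S * (card V + card {(u, v). u \<in> V \<and> v \<in> V \<and> E u v})"
    by (simp only: of_nat_le_iff)
  with S show ?thesis by blast
qed

section \<open>W shapes in abelian groups\<close>

definition AP_free :: "'g::ab_group_add set \<Rightarrow> bool" where
  "AP_free R \<longleftrightarrow> (\<forall>x\<in>R. \<forall>y\<in>R. \<forall>z\<in>R. x + z = y + y \<longrightarrow> x = y \<and> y = z)"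

text \<open>Keeping first term and difference, rather than the bare set, preserves which term is
  first, middle and last.\<close>

definition AP :: "'g::ab_group_add \<times> 'g \<Rightarrow> 'g set" where
  "AP = (\<lambda>(x, d). {x, x + d, x + d + d})"

text \<open>Progressions are removed one after another until none remains. By \<open>no2\<close> a
  nonzero difference gives three distinct terms, so each removal costs exactly three points.\<close>

lemma disjoint_APs:
  fixes A :: "'g::ab_group_add set"
  assumes "finite A" and no2: "\<forall>x::'g. x + x = 0 \<longrightarrow> x = 0"
  shows "\<exists>P R. finite P \<and> R \<subseteq> A \<and> AP_free R \<and> card A = card R + 3 * card P \<and>
    (\<forall>i\<in>P. snd i \<noteq> 0 \<and> AP i \<subseteq> A) \<and> disjoint_family_on AP P"
  using assms(1)
proof (induction A rule: finite_psubset_induct)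
  case (psubset A)
  show ?case
  proof (cases "AP_free A")
    case True
    then show ?thesis
      by (intro exI[of _ "{}"] exI[of _ A]) (simp add: disjoint_family_on_def)
  next
    case False
    then obtain x y z where xyz: "x \<in> A" "y \<in> A" "z \<in> A" "x + z = y + y" "x \<noteq> y \<or> y \<noteq> z"
      by (auto simp: AP_free_def)
    define d where "d = y - x"
    have y: "y = x + d" and z: "z = x + d + d"
      using xyz(4) by (auto simp: d_def algebra_simps)
    have d: "d \<noteq> 0" "d + d \<noteq> 0" using xyz(5) no2[rule_format, of d] by (auto simp: y z)
    let ?T = "AP (x, d)"
    have T_eq: "?T = {x, y, z}" by (simp only: AP_def prod.case y z)
    have "x \<noteq> y" "x \<noteq> z" "y \<noteq> z" using d by (simp_all add: y z add.assoc)
    then have T: "?T \<subseteq> A" "card ?T = 3" using xyz(1-3) by (simp_all add: T_eq)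
    have "A - ?T \<subset> A" using T xyz(1) by (auto simp: AP_def)
    from psubset.IH[OF this] obtain P R where PR: "finite P" "R \<subseteq> A - ?T" "AP_free R"
      "card (A - ?T) = card R + 3 * card P" "\<forall>i\<in>P. snd i \<noteq> 0 \<and> AP i \<subseteq> A - ?T"
      "disjoint_family_on AP P" by blast
    have "(x, d) \<notin> P" using PR(5) by (auto simp: AP_def)
    moreover have "card A = card (A - ?T) + 3"
      using card_Diff_subset[of ?T A] card_mono[of A ?T] T psubset.hyps by (simp add: AP_def)
    moreover have "disjoint_family_on AP (insert (x, d) P)"
      using PR(5,6) unfolding disjoint_family_on_def by blast
    ultimately show ?thesis using PR d T
      by (intro exI[of _ "insert (x, d) P"] exI[of _ R]) auto
  qed
qed

text \<open>The hypothesis \<open>W\<close> forbids a progression with a further pair of the same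
  difference disjoint from it: the four listed \<open>y\<close> are those for which \<open>y\<close>
  or \<open>y + d\<close> meets the progression. Hence solutions have distinct and never opposite
  differences, which gives \<open>2 * card Sol \<le> card V\<close>. An independent set in the graph
  of the off-diagonal solutions is the required \<open>S\<close>.\<close>

lemma W_free_tricolored:
  fixes V A :: "'g::ab_group_add set" and a b c :: "'i \<Rightarrow> 'g"
  assumes finV: "finite V" and AV: "A \<subseteq> V"
    and Vdiff: "\<And>x y. x \<in> V \<Longrightarrow> y \<in> V \<Longrightarrow> x - y \<in> V"
    and no2: "\<forall>x::'g. x + x = 0 \<longrightarrow> x = 0"
    and W: "\<And>x y d. d \<noteq> 0 \<Longrightarrow> {x, x + d, x + d + d, y, y + d} \<subseteq> A \<Longrightarrow>
      y \<in> {x - d, x, x + d, x + d + d}"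
    and finP: "finite P"
    and inA: "\<And>i. i \<in> P \<Longrightarrow> a i \<in> A" "\<And>i. i \<in> P \<Longrightarrow> b i \<in> A" "\<And>i. i \<in> P \<Longrightarrow> c i \<in> A"
    and inj: "inj_on a P" "inj_on b P" "inj_on c P"
    and disj: "\<And>i j. i \<in> P \<Longrightarrow> j \<in> P \<Longrightarrow> a i \<noteq> b j" "\<And>i j. i \<in> P \<Longrightarrow> j \<in> P \<Longrightarrow> a i \<noteq> c j"
      "\<And>i j. i \<in> P \<Longrightarrow> j \<in> P \<Longrightarrow> b i \<noteq> c j"
    and AP: "\<And>i. i \<in> P \<Longrightarrow> a i + c i = b i + b i"
  shows "\<exists>S\<subseteq>P. (card P)\<^sup>2 \<le> card S * card V \<and>
    (\<forall>i\<in>S. \<forall>j\<in>S. \<forall>k\<in>S. a i + c k = b j + b j \<longleftrightarrow> i = j \<and> j = k)"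
proof -
  define Sol where "Sol = {(i, j, k). i \<in> P \<and> j \<in> P \<and> k \<in> P \<and> a i + c k = b j + b j}"
  define D where "D = (\<lambda>(i, j, k :: 'i). b j - a i)"
  have finSol: "finite Sol"
    by (rule finite_subset[of _ "P \<times> P \<times> P"]) (use finP in \<open>auto simp: Sol_def\<close>)
  have c_eq: "c k = a i + (b j - a i) + (b j - a i)" if "(i, j, k) \<in> Sol" for i j k
    using that by (simp add: Sol_def algebra_simps eq_diff_eq)
  have diff_nz: "b j - a i \<noteq> 0" if "i \<in> P" "j \<in> P" for i j
    using disj(1)[OF that] by auto
  \<comment> \<open>Two solutions with the same difference, or with opposite differences, would combine to a
    W shape in \<open>A\<close>.\<close>
  have pair: "y \<in> {a i - d, a i, b j, c k}"
    if "(i, j, k) \<in> Sol" "d = b j - a i" "y \<in> A" "y + d \<in> A" for i j k y d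
  proof -
    have P: "i \<in> P" "j \<in> P" "k \<in> P" using that(1) by (auto simp: Sol_def)
    have "a i + d = b j" "a i + d + d = c k" using c_eq[OF that(1)] by (auto simp: that(2))
    with W[of d "a i" y] diff_nz[OF P(1,2)] inA P that(2-4) show ?thesis by simp
  qed
  have "(i, j, k) = (i', j', k')"
    if s: "(i, j, k) \<in> Sol" "(i', j', k') \<in> Sol" "D (i, j, k) = D (i', j', k')" for i j k i' j' k'
  proof -
    have P: "i \<in> P" "j \<in> P" "k \<in> P" "i' \<in> P" "j' \<in> P" "k' \<in> P" using s by (auto simp: Sol_def)
    define d where "d = b j - a i"
    have d: "d = b j' - a i'" using s(3) by (simp add: D_def d_def)
    have b': "a i' + d = b j'" by (simp add: d)
    \<comment> \<open>The value \<open>a i - d\<close> would give \<open>b j' = a i\<close>, and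
      \<open>b j\<close>, \<open>c k\<close> belong to other classes; only \<open>a i\<close> is
      left.\<close>
    have "a i' \<in> {a i - d, a i, b j, c k}"
      using inA P b' by (intro pair[OF s(1) d_def]) auto
    moreover have "a i' \<noteq> a i - d" using disj(1)[of i j'] P b' by auto
    ultimately have "a i = a i'" using disj P by auto
    then have "b j = b j'" using d by (simp add: d_def)
    moreover have "c k = c k'" using c_eq[OF s(1)] c_eq[OF s(2)] \<open>a i = a i'\<close> \<open>b j = b j'\<close> by simp
    ultimately show ?thesis
      using \<open>a i = a i'\<close> inj P by (auto dest: inj_onD)
  qed
  then have "inj_on D Sol" unfolding inj_on_def by fast
  moreover have "D ` Sol \<inter> uminus ` D ` Sol = {}"
  proof (rule ccontr)
    assume "D ` Sol \<inter> uminus ` D ` Sol \<noteq> {}"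
    then obtain i j k i' j' k' where s: "(i, j, k) \<in> Sol" "(i', j', k') \<in> Sol"
      "D (i, j, k) = - D (i', j', k')" by auto
    have P: "i \<in> P" "j \<in> P" "k \<in> P" "i' \<in> P" "j' \<in> P" "k' \<in> P" using s by (auto simp: Sol_def)
    define d where "d = b j - a i"
    have d: "b j' - a i' = - d" using s(3) by (simp add: D_def d_def)
    have a': "b j' + d = a i'" using d by (simp add: algebra_simps)
    have b': "c k' + d = b j'" unfolding c_eq[OF s(2)] d unfolding a'[symmetric] by simp
    \<comment> \<open>Read backwards, the second solution is \<open>c k'\<close>,
      \<open>b j'\<close>, \<open>a i'\<close> with difference \<open>d\<close>. Its middle term can
      only be \<open>a i - d\<close>, since \<open>b j' = b j\<close> would give
      \<open>a i' = c k\<close>. Its first term can then only be \<open>c k = a i + d + d\<close>,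
      which yields \<open>4d = 0\<close>.\<close>
    have "b j' \<in> {a i - d, a i, b j, c k}"
      using inA P a' by (intro pair[OF s(1) d_def]) auto
    moreover have "b j' \<noteq> a i" "b j' \<noteq> c k" using disj P by metis+
    moreover have "b j' \<noteq> b j"
      using a' c_eq[OF s(1)] disj(2)[of i' k] P by (auto simp: d_def)
    ultimately have 1: "b j' = a i - d" by auto
    have "c k' \<in> {a i - d, a i, b j, c k}"
      using inA P b' by (intro pair[OF s(1) d_def]) auto
    moreover have "c k' \<noteq> a i" "c k' \<noteq> b j" using disj P by metis+
    moreover have "c k' \<noteq> a i - d" using 1 disj(3)[of j' k'] P by auto
    ultimately have "c k' = a i + d + d"
      using c_eq[OF s(1)] by (auto simp: d_def)
    then have "a i + d + d + d = a i - d" using b' 1 by simp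
    then have "(d + d) + (d + d) = 0" by (simp add: eq_diff_eq add.assoc)
    then have "d = 0" using no2 by blast
    then show False using diff_nz P by (simp add: d_def)
  qed
  ultimately have "2 * card Sol = card (D ` Sol \<union> uminus ` D ` Sol)"
    using finSol by (subst card_Un_disjoint) (simp_all add: card_image)
  also have "\<dots> \<le> card V"
  proof (intro card_mono finV Un_least)
    have "b j - a i \<in> V" "- (b j - a i) \<in> V" if "i \<in> P" "j \<in> P" for i j
      unfolding minus_diff_eq using that inA AV Vdiff by blast+
    then show "D ` Sol \<subseteq> V" "uminus ` D ` Sol \<subseteq> V"
      by (auto simp: D_def Sol_def)
  qed
  finally have card_Sol: "2 * card Sol \<le> card V" .
  define Diag where "Diag = (\<lambda>i. (i, i, i)) ` P"
  have Diag: "Diag \<subseteq> Sol" "card Diag = card P"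
    using AP by (auto simp: Diag_def Sol_def card_image inj_on_def)
  \<comment> \<open>An edge records the first two indices of a solution; once these agree,
    \<open>AP\<close> and the injectivity of \<open>c\<close> settle the third.\<close>
  define E where "E i j \<longleftrightarrow> i \<noteq> j \<and> (\<exists>k. (i, j, k) \<in> Sol \<or> (j, i, k) \<in> Sol)" for i j
  let ?E = "{(i, j). i \<in> P \<and> j \<in> P \<and> E i j}"
  let ?f = "\<lambda>(i, j, k :: 'i). (i, j)" and ?g = "\<lambda>(i, j, k :: 'i). (j, i)"
  have "?E \<subseteq> ?f ` (Sol - Diag) \<union> ?g ` (Sol - Diag)"
    by (force simp: E_def Diag_def)
  then have "card ?E \<le> card (?f ` (Sol - Diag) \<union> ?g ` (Sol - Diag))"
    using finSol by (intro card_mono) auto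
  also have "\<dots> \<le> card (?f ` (Sol - Diag)) + card (?g ` (Sol - Diag))"
    by (rule card_Un_le)
  also have "\<dots> \<le> card (Sol - Diag) + card (Sol - Diag)"
    using finSol by (intro add_mono card_image_le) auto
  \<comment> \<open>Each off-diagonal solution yields at most two ordered edges, so
    \<open>card P + card ?E\<close> is at most \<open>2 * card Sol - card P\<close>.\<close>
  also have "\<dots> = 2 * (card Sol - card P)"
    using Diag finSol by (simp add: card_Diff_subset finite_subset)
  finally have card_E: "card P + card ?E \<le> card V"
    using card_Sol card_mono[OF finSol Diag(1)] Diag(2) by linarith
  have E: "E u v \<Longrightarrow> E v u" "\<not> E v v" for u v by (auto simp: E_def)
  obtain S where S: "S \<subseteq> P" "\<forall>u\<in>S. \<forall>v\<in>S. \<not> E u v" "(card P)\<^sup>2 \<le> card S * (card P + card ?E)"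
    using turan_independent_set[of P E, OF finP E] by blast
  have "(card P)\<^sup>2 \<le> card S * card V"
    using S(3) card_E by (meson le_trans mult_le_mono2)
  moreover have "a i + c k = b j + b j \<longleftrightarrow> i = j \<and> j = k" if "i \<in> S" "j \<in> S" "k \<in> S" for i j k
  proof
    assume eq: "a i + c k = b j + b j"
    have P: "i \<in> P" "j \<in> P" "k \<in> P" using that S(1) by auto
    with eq have "(i, j, k) \<in> Sol" by (simp add: Sol_def)
    then have "i = j" using S(2) that by (auto simp: E_def)
    with eq AP[OF P(1)] have "a i + c k = a i + c i" by simp
    then have "c k = c i" by simp
    with \<open>i = j\<close> show "i = j \<and> j = k" using inj(3) P by (auto dest: inj_onD)
  qed (use AP that S(1) in auto)
  ultimately show ?thesis using S(1) by blast
qed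

text \<open>The bound \<open>K\<close> for tricolored sets is used twice: on the progression-free
  rest \<open>R\<close>, and on the subfamily \<open>S\<close> of the \<open>N\<close> disjoint
  progressions.\<close>

lemma W_free_card_le:
  fixes V A :: "'g::ab_group_add set"
  assumes finV: "finite V" and AV: "A \<subseteq> V"
    and Vdiff: "\<And>x y. x \<in> V \<Longrightarrow> y \<in> V \<Longrightarrow> x - y \<in> V"
    and no2: "\<forall>x::'g. x + x = 0 \<longrightarrow> x = 0"
    and W: "\<And>x y d. d \<noteq> 0 \<Longrightarrow> {x, x + d, x + d + d, y, y + d} \<subseteq> A \<Longrightarrow>
      y \<in> {x - d, x, x + d, x + d + d}"
    and tri: "\<And>(S :: ('g \<times> 'g) set) a b c. finite S \<Longrightarrow> a ` S \<union> b ` S \<union> c ` S \<subseteq> V \<Longrightarrow>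
      \<forall>i\<in>S. \<forall>j\<in>S. \<forall>k\<in>S. a i + c k = b j + b j \<longleftrightarrow> i = j \<and> j = k \<Longrightarrow> card S \<le> K"
  shows "\<exists>N. card A \<le> K + 3 * N \<and> N\<^sup>2 \<le> K * card V"
proof -
  have finA: "finite A" using AV finV by (rule finite_subset)
  obtain P R where PR: "finite P" "R \<subseteq> A" "AP_free R" "card A = card R + 3 * card P"
    "\<forall>i\<in>P. snd i \<noteq> 0 \<and> AP i \<subseteq> A" "disjoint_family_on AP P"
    using disjoint_APs[OF finA no2] by blast
  \<comment> \<open>The assumption \<open>tri\<close> speaks of index sets of pairs, so
    \<open>R\<close> is embedded with second component 0 and all three maps are
    \<open>fst\<close>.\<close>
  have "card (R \<times> {0::'g}) \<le> K"
  proof (rule tri[where a = fst and b = fst and c = fst])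
    show "finite (R \<times> {0::'g})" using finite_subset[OF PR(2) finA] by simp
    show "fst ` (R \<times> {0::'g}) \<union> fst ` (R \<times> {0::'g}) \<union> fst ` (R \<times> {0::'g}) \<subseteq> V" using PR(2) AV by auto
    show "\<forall>i\<in>R \<times> {0::'g}. \<forall>j\<in>R \<times> {0}. \<forall>k\<in>R \<times> {0}.
        fst i + fst k = fst j + fst j \<longleftrightarrow> i = j \<and> j = k"
    proof (intro ballI iffI)
      fix i j k assume ijk: "i \<in> R \<times> {0::'g}" "j \<in> R \<times> {0::'g}" "k \<in> R \<times> {0::'g}"
        and eq: "fst i + fst k = fst j + fst j"
      have "fst i \<in> R" "fst j \<in> R" "fst k \<in> R" using ijk by auto
      from PR(3)[unfolded AP_free_def, rule_format, OF this eq]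
      show "i = j \<and> j = k" using ijk by (simp add: prod_eq_iff mem_Times_iff)
    qed simp
  qed
  then have R: "card R \<le> K" by (simp add: card_cartesian_product)
  define b c where "b i = fst i + snd i" and "c i = fst i + snd i + snd i" for i :: "'g \<times> 'g"
  have AP: "AP i = {fst i, b i, c i}" for i by (cases i) (simp add: AP_def b_def c_def)
  have nz: "fst i \<noteq> b i" "fst i \<noteq> c i" "b i \<noteq> c i" if "i \<in> P" for i
    using bspec[OF PR(5) that] no2[rule_format, of "snd i"] by (auto simp: b_def c_def add.assoc)
  have dis: "AP i \<inter> AP j = {}" if "i \<in> P" "j \<in> P" "i \<noteq> j" for i j
    using PR(6) that by (simp add: disjoint_family_on_def)
  have inA: "fst i \<in> A" "b i \<in> A" "c i \<in> A" if "i \<in> P" for i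
    using bspec[OF PR(5) that] by (auto simp: AP)
  have "\<exists>S\<subseteq>P. (card P)\<^sup>2 \<le> card S * card V \<and>
      (\<forall>i\<in>S. \<forall>j\<in>S. \<forall>k\<in>S. fst i + c k = b j + b j \<longleftrightarrow> i = j \<and> j = k)"
    proof (rule W_free_tricolored[OF finV AV _ no2 _ PR(1)])
      show "inj_on fst P" "inj_on b P" "inj_on c P"
        using dis unfolding AP inj_on_def by blast+
      show "fst i \<noteq> b j" "fst i \<noteq> c j" "b i \<noteq> c j" if "i \<in> P" "j \<in> P" for i j
        using dis[OF that] nz[OF that(1)] unfolding AP by blast+
      show "fst i \<in> A" "b i \<in> A" "c i \<in> A" if "i \<in> P" for i
        using inA[OF that] .
      show "fst i + c i = b i + b i" for i
        by (simp add: b_def c_def algebra_simps)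
      show "x - y \<in> V" if "x \<in> V" "y \<in> V" for x y
        using Vdiff[OF that] .
      show "y \<in> {x - d, x, x + d, x + d + d}"
        if "d \<noteq> 0" "{x, x + d, x + d + d, y, y + d} \<subseteq> A" for x y d
        using W[OF that] .
    qed
  then obtain S where S: "S \<subseteq> P" "(card P)\<^sup>2 \<le> card S * card V"
    "\<forall>i\<in>S. \<forall>j\<in>S. \<forall>k\<in>S. fst i + c k = b j + b j \<longleftrightarrow> i = j \<and> j = k"
    by (elim exE conjE)
  have "card S \<le> K"
  proof (rule tri[OF _ _ S(3)])
    show "finite S" using S(1) PR(1) by (rule finite_subset)
    show "fst ` S \<union> b ` S \<union> c ` S \<subseteq> V" using S(1) AV inA by blast
  qed
  then have "(card P)\<^sup>2 \<le> K * card V" using S(2) by (meson le_trans mult_le_mono1)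
  with R PR(4) show ?thesis by (intro exI[of _ "card P"]) auto
qed

section \<open>The constants\<close>

lemma Lambda_le:
  assumes "\<alpha> > 0" "u \<in> {0<..1}"
  shows "Lambda m \<alpha> h \<le> u powr (-(\<alpha> * real h)) * (\<Sum>i\<le>m * h. u ^ i)"
  using Lambda_min[OF assms(1)] assms(2) by blast

text \<open>Both functions are compared at the minimizer of the larger one; as \<open>u\<close> is
  at most 1, each factor grows with its parameter.\<close>

lemma Lambda_mono:
  assumes "0 < \<alpha>" "\<alpha> \<le> \<beta>" "m \<le> m'"
  shows "Lambda m \<alpha> h \<le> Lambda m' \<beta> h"
proof -
  have "\<beta> > 0" using assms by simp
  from Lambda_min[OF this] obtain u where u: "u \<in> {0<..1}"
    "Lambda m' \<beta> h = u powr (-(\<beta> * real h)) * (\<Sum>i\<le>m' * h. u ^ i)" by blast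
  have "Lambda m \<alpha> h \<le> u powr (-(\<alpha> * real h)) * (\<Sum>i\<le>m * h. u ^ i)"
    using assms(1) u(1) by (rule Lambda_le)
  also have "\<dots> \<le> Lambda m' \<beta> h"
    unfolding u(2)
  proof (intro mult_mono sum_mono2)
    show "u powr (-(\<alpha> * real h)) \<le> u powr (-(\<beta> * real h))"
      using u(1) mult_right_mono[OF assms(2), of "real h"] by (intro powr_mono') auto
    show "{..m * h} \<subseteq> {..m' * h}" using mult_le_mono1[OF assms(3), of h] by (simp add: atMost_subset_iff)
  qed (use u(1) in \<open>auto intro: sum_nonneg\<close>)
  finally show ?thesis .
qed

text \<open>The constraint forces \<alpha> \<ge> 1/3 or \<beta> > 1/2, and
  \<open>Lambda_mono\<close> applies in either case.\<close>

lemma Lambda_third_le_max: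
  assumes "3 * \<alpha> + 2 * \<beta> = (2::real)" "\<alpha> \<ge> 0" "\<beta> \<ge> 0"
  shows "Lambda 1 (1 / 3) h \<le> max (Lambda 1 \<alpha> h) (Lambda 2 \<beta> h)"
proof (cases "\<alpha> \<ge> 1 / 3")
  case True
  then have "Lambda 1 (1 / 3) h \<le> Lambda 1 \<alpha> h" by (intro Lambda_mono) auto
  then show ?thesis by simp
next
  case False
  then have "Lambda 1 (1 / 3) h \<le> Lambda 2 \<beta> h" using assms by (intro Lambda_mono) auto
  then show ?thesis by simp
qed

text \<open>Lets the bound obtained with \<open>Lambda 1 (1/3)\<close> be stated with the constant
  \<open>C_W\<close>.\<close>

lemma Lambda_third_le_C_W: "Lambda 1 (1 / 3) (p - 1) \<le> C_W p"
  unfolding C_W_def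
proof (rule cInf_greatest)
  have "3 * 0 + 2 * 1 = (2::real) \<and> (0::real) \<ge> 0 \<and> (1::real) \<ge> 0" by simp
  then show "{max (Lambda 1 \<alpha> (p - 1)) (Lambda 2 \<beta> (p - 1)) | \<alpha> \<beta>.
     3 * \<alpha> + 2 * \<beta> = 2 \<and> \<alpha> \<ge> 0 \<and> \<beta> \<ge> 0} \<noteq> {}" by blast
qed (use Lambda_third_le_max in blast)

text \<open>At \<open>u = 1\<close> the function equals \<open>h + 1\<close> and has derivative
  \<open>(1/2 - \<alpha>) * h * (h + 1) > 0\<close>, so its value drops just to the left of
  1.\<close>

lemma Lambda_1_less:
  assumes "0 < \<alpha>" "\<alpha> < 1 / 2" "h > 0"
  shows "Lambda 1 \<alpha> h < real h + 1"
proof -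
  define c where "c = \<alpha> * real h"
  let ?f = "\<lambda>u::real. u powr (-c) * (\<Sum>i\<le>h. u ^ i)"
  define D where "D = -c * (real h + 1) + (\<Sum>i\<le>h. real i)"
  have "(?f has_real_derivative D) (at 1)"
    unfolding D_def by (rule derivative_eq_intros refl | simp)+
  moreover have "D > 0"
  proof -
    have "2 * (\<Sum>i\<le>h. real i) = real h * (real h + 1)"
      using double_gauss_sum[of h, where 'a = real] by (simp add: atMost_atLeast0)
    then have "2 * D = (1 - 2 * \<alpha>) * (real h * (real h + 1))"
      by (simp add: D_def c_def algebra_simps)
    moreover have "(1 - 2 * \<alpha>) * (real h * (real h + 1)) > 0" using assms by simp
    ultimately show ?thesis by linarith
  qed
  ultimately obtain d where d: "d > 0" "\<And>e. 0 < e \<Longrightarrow> e < d \<Longrightarrow> ?f (1 - e) < ?f 1"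
    using DERIV_pos_inc_left by blast
  define e where "e = min (d / 2) (1 / 2)"
  have e: "0 < e" "e < d" "1 - e \<in> {0<..1}" using d(1) by (auto simp: e_def min_def)
  have "Lambda 1 \<alpha> h \<le> ?f (1 - e)" using Lambda_le[OF assms(1) e(3), of 1 h] by (simp add: c_def)
  also have "\<dots> < ?f 1" using e d(2) by blast
  finally show ?thesis by simp
qed

text \<open>The Taylor polynomial of degree 5 at -3/5 is a lower bound because the remainder carries
  an even power; then reciprocals are taken.\<close>

lemma exp_3_5_less: "exp (3 / 5 :: real) < 11 / 6"
proof -
  obtain t :: real where "exp (- 3 / 5 :: real) =
      (\<Sum>m<6. (- 3 / 5) ^ m / fact m) + exp t / fact 6 * (- 3 / 5) ^ 6"
    using Maclaurin_exp_le[of "- 3 / 5" 6] by blast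
  moreover have "exp t / fact 6 * (- 3 / 5) ^ 6 \<ge> 0" by simp
  ultimately have "exp (- 3 / 5 :: real) \<ge> (\<Sum>m<6. (- 3 / 5) ^ m / fact m)" by linarith
  also have "(\<Sum>m<6. (- 3 / 5) ^ m / fact m) = (34297 / 62500 :: real)"
    by (simp add: eval_nat_numeral)
  finally have "exp (- 3 / 5 :: real) > 6 / 11" by simp
  then have "1 / exp (- 3 / 5 :: real) < 1 / (6 / 11)" by (intro divide_strict_left_mono) auto
  moreover have "1 / exp (- 3 / 5 :: real) = exp (3 / 5)" using exp_minus[of "- 3 / 5 :: real"] by (simp add: inverse_eq_divide)
  ultimately show ?thesis by simp
qed

lemma exp_ge_cubic:
  fixes s :: real
  assumes "s \<ge> 0"
  shows "1 + s + s\<^sup>2 / 2 + s ^ 3 / 6 \<le> exp s"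
proof -
  obtain t :: real where t: "exp s = (\<Sum>m<4. s ^ m / fact m) + exp t / fact 4 * s ^ 4"
    using Maclaurin_exp_le[of s 4] by blast
  moreover have "exp t / fact 4 * s ^ 4 \<ge> 0" by simp
  moreover have "(\<Sum>m<4. s ^ m / fact m) = 1 + s + s\<^sup>2 / 2 + s ^ 3 / 6"
    by (simp add: eval_nat_numeral)
  ultimately show ?thesis by linarith
qed

text \<open>The choice \<open>u = exp (-2/h)\<close> makes the prefactor \<open>exp (3/5)\<close>,
  free of \<open>h\<close>, and the geometric sum is at most \<open>1 / (1 - u)\<close>. What
  remains is \<open>11/6 \<le> (h + 1) * (1 - u)\<close>, that is
  \<open>11/6 * s \<le> (2 + s) * (1 - exp (-s))\<close> for \<open>s = 2/h\<close> in
  (0,1].\<close>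

lemma Lambda_2_less:
  assumes "h \<ge> 2"
  shows "Lambda 2 (3 / 10) h < real h + 1"
proof -
  define s where "s = 2 / real h"
  have s: "0 < s" "s \<le> 1" "real h * s = 2" using assms by (auto simp: s_def)
  define u where "u = exp (- s)"
  have u: "0 < u" "u < 1" using s by (auto simp: u_def)
  \<comment> \<open>\<open>q\<close> is the cubic Taylor polynomial of \<open>exp s\<close>, so
    \<open>u \<le> 1 / q\<close>; the aim becomes
    \<open>11/6 * s * q \<le> (2 + s) * (q - 1)\<close>, where \<open>q - 1\<close> is divisible by
    \<open>s\<close>.\<close>
  define q where "q = 1 + s + s\<^sup>2 / 2 + s ^ 3 / 6"
  have "q > 0" "q \<le> exp s" using s exp_ge_cubic[of s] by (auto simp: q_def intro!: add_pos_nonneg)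
  then have "u \<le> 1 / q" by (simp add: u_def exp_minus field_simps)
  have "s\<^sup>2 \<le> s" "s ^ 3 \<le> s" using s power_decreasing[of 1 2 s] power_decreasing[of 1 3 s] by simp_all
  moreover have "(2 + s) * (1 + s / 2 + s\<^sup>2 / 6) = 2 + 2 * s + 5 / 6 * s\<^sup>2 + s ^ 3 / 6"
    by (simp add: field_simps power2_eq_square power3_eq_cube)
  \<comment> \<open>With \<open>s^2\<close> and \<open>s^3\<close> estimated by \<open>s\<close>,
    the right side exceeds the left by at least \<open>1/6 - s/18\<close>, which is positive for
    \<open>s \<le> 1\<close>.\<close>
  ultimately have "11 / 6 * q \<le> (2 + s) * (1 + s / 2 + s\<^sup>2 / 6)"
    unfolding q_def using s(1,2) by (simp only: distrib_left)
  then have "11 / 6 * q * s \<le> (2 + s) * (1 + s / 2 + s\<^sup>2 / 6) * s"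
    using s(1) by (intro mult_right_mono) auto
  also have "\<dots> = (2 + s) * (1 - 1 / q) * q"
    using \<open>q > 0\<close> by (simp add: left_diff_distrib q_def)
      (simp add: field_simps power2_eq_square power3_eq_cube)
  finally have "(11 / 6 * s) * q \<le> (2 + s) * (1 - 1 / q) * q"
    by (simp only: mult.assoc mult.commute[of q s])
  then have "11 / 6 * s \<le> (2 + s) * (1 - 1 / q)"
    by (simp only: mult_le_cancel_right_pos[OF \<open>q > 0\<close>])
  also have "\<dots> \<le> (2 + s) * (1 - u)"
    using \<open>u \<le> 1 / q\<close> s by (intro mult_left_mono) auto
  also have "2 + s = (real h + 1) * s"
    using s(3) by (simp add: distrib_right)
  also have "(real h + 1) * s * (1 - u) = (real h + 1) * (1 - u) * s"
    by (simp only: mult_ac)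
  finally have "11 / 6 \<le> (real h + 1) * (1 - u)"
    using s(1) by (simp only: mult_le_cancel_right_pos)
  then have 1: "11 / 6 / (1 - u) \<le> real h + 1" using u by (simp only: pos_divide_le_eq diff_gt_0_iff_gt)
  have "u powr (- (3 / 10 * real h)) = exp (3 / 10 * (real h * s))"
    by (simp add: u_def powr_def)
  then have "u powr (- (3 / 10 * real h)) = exp (3 / 5)" unfolding s(3) by simp
  then have "Lambda 2 (3 / 10) h \<le> exp (3 / 5) * (\<Sum>i\<le>2 * h. u ^ i)"
    using Lambda_le[of "3 / 10" u 2 h] u by simp
  also have "\<dots> \<le> exp (3 / 5) * (1 / (1 - u))"
    using u by (intro mult_left_mono) (simp_all add: sum_gp0 divide_right_mono)
  also have "\<dots> < 11 / 6 * (1 / (1 - u))"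
    using u exp_3_5_less by (intro mult_strict_right_mono) auto
  finally show ?thesis using 1 by simp
qed

lemma C_W_less:
  assumes "p \<ge> 3"
  shows "C_W p < real p"
proof -
  let ?S = "{max (Lambda 1 \<alpha> (p - 1)) (Lambda 2 \<beta> (p - 1)) | \<alpha> \<beta>.
     3 * \<alpha> + 2 * \<beta> = 2 \<and> \<alpha> \<ge> 0 \<and> \<beta> \<ge> 0}"
  have "bdd_below ?S"
    by (rule bdd_belowI[of _ "Lambda 1 (1 / 3) (p - 1)"]) (use Lambda_third_le_max in blast)
  \<comment> \<open>\<open>Lambda 1 \<alpha>\<close> is below \<open>p\<close> only for \<open>\<alpha> < 1 / 2\<close>, that is \<open>\<beta> > 1 / 4\<close>, while \<open>\<beta>\<close> must stay
    close to \<open>1 / 4\<close> for \<open>Lambda 2 \<beta>\<close> to be below \<open>p\<close> already when \<open>p = 3\<close>.\<close>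
  moreover have "3 * (7 / 15) + 2 * (3 / 10) = (2::real) \<and> (7 / 15 :: real) \<ge> 0 \<and> (3 / 10 :: real) \<ge> 0"
    by simp
  then have "max (Lambda 1 (7 / 15) (p - 1)) (Lambda 2 (3 / 10) (p - 1)) \<in> ?S" by blast
  ultimately have "C_W p \<le> max (Lambda 1 (7 / 15) (p - 1)) (Lambda 2 (3 / 10) (p - 1))"
    unfolding C_W_def by (intro cInf_lower)
  also have "\<dots> < real p"
    using Lambda_1_less[of "7 / 15" "p - 1"] Lambda_2_less[of "p - 1"] assms by simp
  finally show ?thesis .
qed

section \<open>The bound\<close>

text \<open>The map \<open>\<phi> n\<close> extends vectors by zero to functions, which form an
  abelian group under pointwise addition. A W shape is a solution of \<open>T_W\<close> via
  \<open>x1 = x\<close>, \<open>x2 = y\<close>, \<open>x3 = x + d\<close>,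
  \<open>x4 = y + d\<close>, \<open>x5 = x + 2d\<close>, and the excluded values of \<open>y\<close>
  make the five entries distinct.\<close>

lemma weakly_free_T_W_no_W:
  fixes A :: "'a::comm_ring_1 vec set" and x y d :: "nat \<Rightarrow> 'a"
  defines "\<phi> \<equiv> \<lambda>n (v :: 'a vec) c. if c < n then v $ c else 0"
  assumes free: "weakly_free T_W n A" and A: "A \<subseteq> carrier_vec n"
    and no2: "\<forall>x :: nat \<Rightarrow> 'a. x + x = 0 \<longrightarrow> x = 0"
    and d: "d \<noteq> 0" and sub: "{x, x + d, x + d + d, y, y + d} \<subseteq> \<phi> n ` A"
  shows "y \<in> {x - d, x, x + d, x + d + d}"
proof (rule ccontr)
  assume y: "y \<notin> {x - d, x, x + d, x + d + d}"
  obtain v1 v2 v3 v4 v5 where v: "v1 \<in> A" "v2 \<in> A" "v3 \<in> A" "v4 \<in> A" "v5 \<in> A"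
    and \<phi>: "\<phi> n v1 = x" "\<phi> n v2 = y" "\<phi> n v3 = x + d" "\<phi> n v4 = y + d" "\<phi> n v5 = x + d + d"
    using sub by (auto simp: image_iff)
  have at: "v1 $ c = x c" "v2 $ c = y c" "v3 $ c = x c + d c" "v4 $ c = y c + d c"
    "v5 $ c = x c + d c + d c" if "c < n" for c
    using \<phi>[THEN fun_cong, of c] that by (simp_all add: \<phi>_def)
  have "d + d \<noteq> 0" using no2 d by blast
  then have "distinct [x, y, x + d, y + d, x + d + d]"
    using y d by (auto simp: add.assoc eq_diff_eq)
  then have "distinct (map (\<phi> n) [v1, v2, v3, v4, v5])" by (simp only: list.map \<phi>)
  then have dist: "distinct [v1, v2, v3, v4, v5]" unfolding distinct_map ..
  have carr: "v1 \<in> carrier_vec n" "v2 \<in> carrier_vec n" "v3 \<in> carrier_vec n"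
    "v4 \<in> carrier_vec n" "v5 \<in> carrier_vec n" using v A by auto
  have "solves T_W n [v1, v2, v3, v4, v5]"
    unfolding solves_T_W[OF carr]
  proof
    show "v1 - v2 - v3 + v4 = 0\<^sub>v n"
      using carr by (intro eq_vecI) (auto simp: at)
    show "v1 - 2 \<cdot>\<^sub>v v3 + v5 = 0\<^sub>v n"
      using carr by (intro eq_vecI) (auto simp: at algebra_simps)
  qed
  moreover have "set [v1, v2, v3, v4, v5] \<subseteq> A" using v by simp
  ultimately have "\<exists>xs. set xs \<subseteq> A \<and> distinct xs \<and> solves T_W n xs"
    using dist by (intro exI[of _ "[v1, v2, v3, v4, v5]"] conjI)
  with free show False unfolding weakly_free_def by (rule notE)
qed

text \<open>Transfers the group statement to vectors, with the functions vanishing from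
  \<open>n\<close> on in place of the vector space. The trivial bound by the size of the space is
  recorded too, for the case where it is the better one.\<close>

lemma weakly_free_T_W_card_le:
  fixes A :: "'a::finite_field vec set"
  assumes two: "(2 :: 'a) \<noteq> 0" and A: "A \<subseteq> carrier_vec n" and free: "weakly_free T_W n A"
  defines "K \<equiv> 3 * card (low_exps n (CARD('a) - 1))"
  shows "card A \<le> CARD('a) ^ n" and "\<exists>N. card A \<le> K + 3 * N \<and> N\<^sup>2 \<le> K * CARD('a) ^ n"
proof -
  define \<phi> where "\<phi> = (\<lambda>n (v :: 'a vec) c. if c < n then v $ c else 0)"
  define V where "V = {f :: nat \<Rightarrow> 'a. \<forall>c\<ge>n. f c = 0}"
  let ?r = "\<lambda>(g :: nat \<Rightarrow> 'a) c. if c < n then g c else 0"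
  have V_sub: "V \<subseteq> ?r ` ({..<n} \<rightarrow>\<^sub>E UNIV)"
  proof
    fix f assume "f \<in> V"
    then have "f = ?r (restrict f {..<n})" by (auto simp: V_def fun_eq_iff)
    then show "f \<in> ?r ` ({..<n} \<rightarrow>\<^sub>E UNIV)" by (rule image_eqI[where x = "restrict f {..<n}"]) auto
  qed
  have fin: "finite ({..<n} \<rightarrow>\<^sub>E (UNIV :: 'a set))" by (intro finite_PiE) auto
  have finV: "finite V" using V_sub fin by (rule finite_subset[OF _ finite_imageI])
  have "card V \<le> card ({..<n} \<rightarrow>\<^sub>E (UNIV :: 'a set))"
    using card_mono[OF finite_imageI[OF fin] V_sub] card_image_le[OF fin, of ?r] by linarith
  then have cardV: "card V \<le> CARD('a) ^ n" by (simp add: card_PiE)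
  have BV: "\<phi> n ` A \<subseteq> V" by (auto simp: \<phi>_def V_def)
  have "inj_on (\<phi> n) A"
  proof (rule inj_onI)
    fix v w assume vw: "v \<in> A" "w \<in> A" and eq: "\<phi> n v = \<phi> n w"
    have dim: "dim_vec v = n" "dim_vec w = n" using vw A by auto
    show "v = w"
    proof (rule eq_vecI)
      fix c assume "c < dim_vec w"
      then show "v $ c = w $ c" using fun_cong[OF eq, of c] dim by (simp add: \<phi>_def)
    qed (simp add: dim)
  qed
  then have cardB: "card (\<phi> n ` A) = card A" by (rule card_image)
  show "card A \<le> CARD('a) ^ n"
    using card_mono[OF finV BV] cardV cardB by simp
  have no2: "\<forall>x :: nat \<Rightarrow> 'a. x + x = 0 \<longrightarrow> x = 0"
    using two by (auto simp: fun_eq_iff simp flip: mult_2)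
  have "\<exists>N. card (\<phi> n ` A) \<le> K + 3 * N \<and> N\<^sup>2 \<le> K * card V"
  proof (rule W_free_card_le[OF finV BV _ no2])
    show "f - g \<in> V" if "f \<in> V" "g \<in> V" for f g
      using that by (simp add: V_def)
    show "y \<in> {x - d, x, x + d, x + d + d}"
      if "d \<noteq> 0" "{x, x + d, x + d + d, y, y + d} \<subseteq> \<phi> n ` A" for x y d
      using weakly_free_T_W_no_W[OF free A no2 that(1) that(2)[unfolded \<phi>_def]] .
    fix S :: "((nat \<Rightarrow> 'a) \<times> (nat \<Rightarrow> 'a)) set" and a b c
    assume S: "finite S" "a ` S \<union> b ` S \<union> c ` S \<subseteq> V"
      "\<forall>i\<in>S. \<forall>j\<in>S. \<forall>k\<in>S. a i + c k = b j + b j \<longleftrightarrow> i = j \<and> j = k"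
    \<comment> \<open>The middle map becomes \<open>-2b\<close>, so that the progression equation
      turns into a vanishing sum; coordinates from \<open>n\<close> on vanish for members of
      \<open>V\<close>.\<close>
    have "(\<forall>l<n. a i l + - (b j l + b j l) + c k l = 0) \<longleftrightarrow> i = j \<and> j = k"
      if ijk: "i \<in> S" "j \<in> S" "k \<in> S" for i j k
    proof -
      have "a i \<in> V" "b j \<in> V" "c k \<in> V" using S(2) ijk by auto
      then have "a i l + - (b j l + b j l) + c k l = 0" if "n \<le> l" for l
        using that by (simp add: V_def)
      then have "(\<forall>l<n. a i l + - (b j l + b j l) + c k l = 0) \<longleftrightarrow>
          (\<forall>l. a i l + - (b j l + b j l) + c k l = 0)"
        by (meson not_le)
      also have "a i l + - (b j l + b j l) + c k l = (a i + c k) l - (b j + b j) l" for l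
        by simp
      then have "(\<forall>l. a i l + - (b j l + b j l) + c k l = 0) \<longleftrightarrow> a i + c k = b j + b j"
        by (simp only: right_minus_eq fun_eq_iff)
      finally show ?thesis using S(3) ijk by simp
    qed
    from tricolored_sum_free_card_le[OF S(1), of n a "\<lambda>j l. - (b j l + b j l)" c, OF this]
    show "card S \<le> K" by (simp add: K_def)
  qed
  then obtain N where N: "card (\<phi> n ` A) \<le> K + 3 * N" "N\<^sup>2 \<le> K * card V" by blast
  have "N\<^sup>2 \<le> K * CARD('a) ^ n" using N(2) mult_le_mono2[OF cardV] by (rule le_trans)
  with N(1) show "\<exists>N. card A \<le> K + 3 * N \<and> N\<^sup>2 \<le> K * CARD('a) ^ n"
    unfolding cardB by blast
qed

text \<open>Let \<open>s = sqrt (L * Q)\<close>. If \<open>Q \<le> 49 * L\<close>, the trivial bound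
  gives \<open>Q \<le> 7 * s\<close>. Otherwise \<open>L \<le> s / 7\<close>, so
  \<open>K \<le> 3/7 * s\<close>, while \<open>sqrt 3 < 7/4\<close> gives
  \<open>N \<le> 7/4 * s\<close>; and \<open>3/7 + 21/4 < 7\<close>.\<close>

lemma seven_sqrt_bound:
  fixes a K N L Q :: real
  assumes "0 \<le> K" "K \<le> 3 * L" "0 \<le> N" "a \<le> K + 3 * N" "N\<^sup>2 \<le> K * Q" "0 \<le> a" "a \<le> Q"
  shows "a \<le> 7 * sqrt (L * Q)"
proof -
  define s where "s = sqrt (L * Q)"
  have L: "L \<ge> 0" and Q: "Q \<ge> 0" using assms by auto
  have s: "s \<ge> 0" "s\<^sup>2 = L * Q" using L Q by (auto simp: s_def)
  show ?thesis
  proof (cases "Q \<le> 49 * L")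
    case True
    have "Q\<^sup>2 \<le> (7 * s)\<^sup>2"
      unfolding power_mult_distrib s(2) using mult_right_mono[OF True Q]
      by (simp add: power2_eq_square mult_ac)
    then have "Q \<le> 7 * s" by (rule power2_le_imp_le) (use s(1) in simp)
    then show ?thesis using assms(7) by (simp add: s_def)
  next
    case False
    then have "49 * L * L \<le> Q * L" using L by (intro mult_right_mono) auto
    then have "(7 * L)\<^sup>2 \<le> s\<^sup>2" unfolding s(2) by (simp add: power2_eq_square mult_ac)
    then have 1: "7 * L \<le> s" using s(1) by (rule power2_le_imp_le)
    have "N\<^sup>2 \<le> 3 * L * Q" using assms(5) mult_right_mono[OF assms(2) Q] by linarith
    moreover have "0 \<le> L * Q" using L Q by simp
    ultimately have "N\<^sup>2 \<le> (7 / 4 * s)\<^sup>2"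
      unfolding power_mult_distrib s(2) by (simp add: power2_eq_square)
    then have "N \<le> 7 / 4 * s" by (rule power2_le_imp_le) (use s(1) in simp)
    with 1 assms(2,4) s(1) show ?thesis unfolding s_def[symmetric] by linarith
  qed
qed

theorem theoremB:
  fixes p :: nat
  assumes "prime p" and "p \<ge> 3" and "CARD('p::prime_card) = p"
  shows "(\<exists>C < real p. \<forall>n. real (ex_sharp (T_W :: 'p mod_ring mat) n) \<le> 7 * sqrt (C * real p) ^ n)
    \<and> (C_W p < real p \<and>
       (\<forall>n. real (ex_sharp (T_W :: 'p mod_ring mat) n) \<le> 7 * sqrt (C_W p * real p) ^ n))"
proof -
  have two: "(2 :: 'p mod_ring) \<noteq> 0"
  proof
    assume "(2 :: 'p mod_ring) = 0"
    then have "CARD('p) dvd 2" using of_nat_0_mod_ring_dvd[of 2, where 'a = 'p] by simp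
    then show False using assms(2,3) dvd_imp_le[of "CARD('p)" 2] by simp
  qed
  let ?\<Lambda> = "Lambda 1 (1 / 3) (p - 1)"
  \<comment> \<open>Evaluating the count of low exponent vectors at a minimizer replaces its base by
    \<open>Lambda 1 (1/3) (p - 1)\<close>.\<close>
  obtain u where u: "u \<in> {0<..1}"
    "?\<Lambda> = u powr (-(1 / 3 * real (p - 1))) * (\<Sum>i\<le>1 * (p - 1). u ^ i)"
    using Lambda_min[of "1 / 3" 1 "p - 1"] by auto
  have \<Lambda>_nonneg: "?\<Lambda> \<ge> 0" unfolding u(2) using u(1) by (intro mult_nonneg_nonneg sum_nonneg) auto
  have "real (ex_sharp (T_W :: 'p mod_ring mat) n) \<le> 7 * sqrt (C_W p * real p) ^ n" for n
  proof -
    define B where "B = 7 * sqrt (C_W p * real p) ^ n"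
    \<comment> \<open>\<open>ex_sharp_le_iff\<close> takes a natural bound; rounding
      \<open>B\<close> down is harmless because \<open>card A\<close> is an integer.\<close>
    have "card A \<le> nat \<lfloor>B\<rfloor>" if A: "A \<subseteq> carrier_vec n" "weakly_free T_W n A" for A :: "'p mod_ring vec set"
    proof -
      let ?M = "card (low_exps n (p - 1))"
      obtain N where N: "card A \<le> 3 * ?M + 3 * N" "N\<^sup>2 \<le> 3 * ?M * p ^ n" and Ap: "card A \<le> p ^ n"
        using weakly_free_T_W_card_le[OF two A] assms(3) by auto
      have M: "real ?M \<le> ?\<Lambda> ^ n"
        using card_low_exps_le[of u n "p - 1"] u by simp
      have "real (card A) \<le> 7 * sqrt (?\<Lambda> ^ n * real p ^ n)"
      proof (rule seven_sqrt_bound)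
        show "real (card A) \<le> 3 * real ?M + 3 * real N"
          using of_nat_mono[OF N(1), where 'a = real] by simp
        show "(real N)\<^sup>2 \<le> 3 * real ?M * real p ^ n"
          using of_nat_mono[OF N(2), where 'a = real] by simp
        show "real (card A) \<le> real p ^ n" using of_nat_mono[OF Ap, where 'a = real] by simp
      qed (use M in auto)
      also have "\<dots> = 7 * sqrt (?\<Lambda> * real p) ^ n"
        by (simp add: real_sqrt_power real_sqrt_mult power_mult_distrib)
      also have "\<dots> \<le> B"
        unfolding B_def using \<Lambda>_nonneg Lambda_third_le_C_W[of p]
        by (intro mult_left_mono power_mono real_sqrt_le_mono mult_right_mono) auto
      finally show ?thesis by linarith
    qed
    then have "ex_sharp (T_W :: 'p mod_ring mat) n \<le> nat \<lfloor>B\<rfloor>"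
      by (subst ex_sharp_le_iff) (auto simp: T_W_def mat_of_rows_list_def)
    moreover have "0 \<le> B"
      unfolding B_def using \<Lambda>_nonneg Lambda_third_le_C_W[of p] by simp
    ultimately show ?thesis unfolding B_def by linarith
  qed
  with C_W_less[OF assms(2)] show ?thesis by blast
qed

end
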